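(* Let $\Gamma$ be a groupoid, $R$ a (object unital) $\Gamma$-graded ring and $M$ a (unital) $\Gamma$-graded right $R$-module. The following assertions hold: (1) $\mathrm{rad}^{\mathrm{gr}}(M)=\sum\{N : N \text{ is a gr-superfluous graded submodule of } M\}$; (2) $\mathrm{soc}_{\mathrm{gr}}(M)=\bigcap\{N : N\text{ is a gr-essential graded submodule of } M\}$.
   Context: A groupoid $\Gamma$ is a small category in which every morphism is invertible. It is identified with its set of morphisms; $\Gamma_0$ is its set of objects, each object being identified with its identity morphism. For $\gamma\in\Gamma$, $d(\gamma)$ and $r(\gamma)$ denote domain and codomain, and $\delta\gamma$ is defined iff $d(\delta)=r(\gamma)$. Rings are associative, not necessarily unital. A $\Gamma$-graded ring is a ring $R=\bigoplus_{\gamma\in\Gamma}R_\gamma$ (additive subgroups) with $R_\gamma R_\delta\subseteq R_{\gamma\delta}$ if $\gamma\delta$ is defined and $R_\gamma R_\delta=0$ otherwise. All graded rings are assumed object unital: for each $e\in\Gamma_0$ the ring $R_e$ has an identity $1_e$ (possibly $0$), and $1_{r(\gamma)}a=a1_{d(\gamma)}=a$ for all $a\in R_\gamma$. A $\Gamma$-graded right $R$-module is a right module $M=\bigoplus_\gamma M_\gamma$ with $M_\sigma R_\tau\subseteq M_{\sigma\tau}$ if $\sigma\tau$ is defined and $M_\sigma R_\tau=0$ otherwise; all graded modules are assumed unital ($MR=M$, equivalently $m1_{d(\sigma)}=m$ for all $m\in M_\sigma$). A graded submodule is a submodule $N=\bigoplus_\gamma (N\cap M_\gamma)$. A graded submodule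 of $M$ is gr-maximal if it is maximal among the graded submodules different from $M$; it is gr-simple if it is minimal among the nonzero graded submodules. $\mathrm{rad}^{\mathrm{gr}}(M)$ is the intersection of all gr-maximal graded submodules of $M$ ($:=M$ if there are none). $\mathrm{soc}_{\mathrm{gr}}(M)$ is the sum of all gr-simple graded submodules of $M$ ($:=0$ if there are none). A graded submodule $N$ of $M$ is gr-superfluous in $M$ if for every graded submodule $X$ of $M$, $N+X=M$ implies $X=M$; it is gr-essential in $M$ if for every graded submodule $X$ of $M$, $N\cap X=0$ implies $X=0$. *)

theory Defs
  imports "HOL-Library.Set_Algebras"
begin

text \<open>
  A groupoid is given by its set of morphisms \<open>\<Gamma>\<close>, objects being identified with
  their identity morphisms. The product \<open>\<delta> \<star> \<gamma>\<close> is meaningful only if \<open>d \<delta> = r \<gamma>\<close>.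
\<close>

locale groupoid =
  fixes \<Gamma> :: "'g set"
    and d r :: "'g \<Rightarrow> 'g"
    and mul :: "'g \<Rightarrow> 'g \<Rightarrow> 'g"  (infixl "\<star>" 70)
  assumes d_closed: "\<gamma> \<in> \<Gamma> \<Longrightarrow> d \<gamma> \<in> \<Gamma>"
    and r_closed: "\<gamma> \<in> \<Gamma> \<Longrightarrow> r \<gamma> \<in> \<Gamma>"
    and d_d: "\<gamma> \<in> \<Gamma> \<Longrightarrow> d (d \<gamma>) = d \<gamma>"
    and r_d: "\<gamma> \<in> \<Gamma> \<Longrightarrow> r (d \<gamma>) = d \<gamma>"
    and d_r: "\<gamma> \<in> \<Gamma> \<Longrightarrow> d (r \<gamma>) = r \<gamma>"
    and r_r: "\<gamma> \<in> \<Gamma> \<Longrightarrow> r (r \<gamma>) = r \<gamma>"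
    and mul_closed: "\<lbrakk>\<delta> \<in> \<Gamma>; \<gamma> \<in> \<Gamma>; d \<delta> = r \<gamma>\<rbrakk> \<Longrightarrow> \<delta> \<star> \<gamma> \<in> \<Gamma>"
    and d_mul: "\<lbrakk>\<delta> \<in> \<Gamma>; \<gamma> \<in> \<Gamma>; d \<delta> = r \<gamma>\<rbrakk> \<Longrightarrow> d (\<delta> \<star> \<gamma>) = d \<gamma>"
    and r_mul: "\<lbrakk>\<delta> \<in> \<Gamma>; \<gamma> \<in> \<Gamma>; d \<delta> = r \<gamma>\<rbrakk> \<Longrightarrow> r (\<delta> \<star> \<gamma>) = r \<delta>"
    and mul_d: "\<gamma> \<in> \<Gamma> \<Longrightarrow> \<gamma> \<star> d \<gamma> = \<gamma>"
    and r_mul_self: "\<gamma> \<in> \<Gamma> \<Longrightarrow> r \<gamma> \<star> \<gamma> = \<gamma>"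
    and mul_assoc: "\<lbrakk>\<epsilon> \<in> \<Gamma>; \<delta> \<in> \<Gamma>; \<gamma> \<in> \<Gamma>; d \<epsilon> = r \<delta>; d \<delta> = r \<gamma>\<rbrakk>
                      \<Longrightarrow> (\<epsilon> \<star> \<delta>) \<star> \<gamma> = \<epsilon> \<star> (\<delta> \<star> \<gamma>)"
    and inverse_exists: "\<gamma> \<in> \<Gamma> \<Longrightarrow>
          \<exists>\<gamma>'\<in>\<Gamma>. d \<gamma>' = r \<gamma> \<and> r \<gamma>' = d \<gamma> \<and> \<gamma>' \<star> \<gamma> = d \<gamma> \<and> \<gamma> \<star> \<gamma>' = r \<gamma>"
begin

definition objects :: "'g set" where
  "objects = {e \<in> \<Gamma>. d e = e}"

end

definition add_subgroup :: "'a::ab_group_add set \<Rightarrow> bool" where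
  "add_subgroup A \<longleftrightarrow> 0 \<in> A \<and> (\<forall>x\<in>A. \<forall>y\<in>A. x + y \<in> A) \<and> (\<forall>x\<in>A. - x \<in> A)"

definition family_sum :: "'i set \<Rightarrow> ('i \<Rightarrow> 'a::ab_group_add set) \<Rightarrow> 'a set" where
  "family_sum I A = {\<Sum>i\<in>F. f i | F f. finite F \<and> F \<subseteq> I \<and> (\<forall>i\<in>F. f i \<in> A i)}"

definition direct_sum :: "'i set \<Rightarrow> ('i \<Rightarrow> 'a::ab_group_add set) \<Rightarrow> 'a set \<Rightarrow> bool" where
  "direct_sum I A S \<longleftrightarrow>
     (\<forall>i\<in>I. add_subgroup (A i)) \<and>
     S = family_sum I A \<and>
     (\<forall>F f. finite F \<and> F \<subseteq> I \<and> (\<forall>i\<in>F. f i \<in> A i) \<and> (\<Sum>i\<in>F. f i) = 0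
        \<longrightarrow> (\<forall>i\<in>F. f i = 0))"

text \<open>
  Rings and modules are whole types. The class \<^class>\<open>ring\<close> does not require
  a multiplicative identity.
\<close>

locale graded_ring = groupoid \<Gamma> d r mul
  for \<Gamma> :: "'g set" and d r :: "'g \<Rightarrow> 'g" and mul :: "'g \<Rightarrow> 'g \<Rightarrow> 'g" (infixl "\<star>" 70) +
  fixes R :: "'g \<Rightarrow> 'r::ring set"
  assumes ring_direct_sum: "direct_sum \<Gamma> R UNIV"
    and ring_mult: "\<lbrakk>\<gamma> \<in> \<Gamma>; \<delta> \<in> \<Gamma>; d \<gamma> = r \<delta>; a \<in> R \<gamma>; b \<in> R \<delta>\<rbrakk>
                      \<Longrightarrow> a * b \<in> R (\<gamma> \<star> \<delta>)"
    and ring_mult_zero: "\<lbrakk>\<gamma> \<in> \<Gamma>; \<delta> \<in> \<Gamma>; d \<gamma> \<noteq> r \<delta>; a \<in> R \<gamma>; b \<in> R \<delta>\<rbrakk> \<Longrightarrow> a * b = 0"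
    and object_unital:
      "\<exists>one. (\<forall>e\<in>objects. one e \<in> R e \<and> (\<forall>a\<in>R e. one e * a = a \<and> a * one e = a)) \<and>
             (\<forall>\<gamma>\<in>\<Gamma>. \<forall>a\<in>R \<gamma>. one (r \<gamma>) * a = a \<and> a * one (d \<gamma>) = a)"

locale right_module =
  fixes act :: "'m::ab_group_add \<Rightarrow> 'r::ring \<Rightarrow> 'm"  (infixl "\<bullet>" 70)
  assumes act_add_left: "(x + y) \<bullet> a = x \<bullet> a + y \<bullet> a"
    and act_add_right: "x \<bullet> (a + b) = x \<bullet> a + x \<bullet> b"
    and act_act: "(x \<bullet> a) \<bullet> b = x \<bullet> (a * b)"

text \<open>The assumption \<open>unital\<close> says \<open>MR = M\<close>, with \<open>MR\<close> the set of finite sums of products.\<close>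

locale graded_module = graded_ring \<Gamma> d r mul R + right_module act
  for \<Gamma> :: "'g set" and d r :: "'g \<Rightarrow> 'g" and mul :: "'g \<Rightarrow> 'g \<Rightarrow> 'g" (infixl "\<star>" 70)
    and R :: "'g \<Rightarrow> 'r::ring set"
    and act :: "'m::ab_group_add \<Rightarrow> 'r \<Rightarrow> 'm" (infixl "\<bullet>" 70) +
  fixes M :: "'g \<Rightarrow> 'm set"
  assumes module_direct_sum: "direct_sum \<Gamma> M UNIV"
    and module_act: "\<lbrakk>\<sigma> \<in> \<Gamma>; \<tau> \<in> \<Gamma>; d \<sigma> = r \<tau>; x \<in> M \<sigma>; a \<in> R \<tau>\<rbrakk> \<Longrightarrow> x \<bullet> a \<in> M (\<sigma> \<star> \<tau>)"
    and module_act_zero: "\<lbrakk>\<sigma> \<in> \<Gamma>; \<tau> \<in> \<Gamma>; d \<sigma> \<noteq> r \<tau>; x \<in> M \<sigma>; a \<in> R \<tau>\<rbrakk> \<Longrightarrow> x \<bullet> a = 0"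
    and unital: "\<exists>ps. x = (\<Sum>(y, a)\<leftarrow>ps. y \<bullet> a)"
begin

definition submodule :: "'m set \<Rightarrow> bool" where
  "submodule N \<longleftrightarrow> add_subgroup N \<and> (\<forall>x\<in>N. \<forall>a. x \<bullet> a \<in> N)"

definition graded_submodule :: "'m set \<Rightarrow> bool" where
  "graded_submodule N \<longleftrightarrow> submodule N \<and> direct_sum \<Gamma> (\<lambda>\<gamma>. N \<inter> M \<gamma>) N"

definition gr_maximal :: "'m set \<Rightarrow> bool" where
  "gr_maximal N \<longleftrightarrow> graded_submodule N \<and> N \<noteq> UNIV \<and>
     (\<forall>X. graded_submodule X \<and> X \<noteq> UNIV \<and> N \<subseteq> X \<longrightarrow> X = N)"

definition gr_simple :: "'m set \<Rightarrow> bool" where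
  "gr_simple N \<longleftrightarrow> graded_submodule N \<and> N \<noteq> {0} \<and>
     (\<forall>X. graded_submodule X \<and> X \<noteq> {0} \<and> X \<subseteq> N \<longrightarrow> X = N)"

definition gr_superfluous :: "'m set \<Rightarrow> bool" where
  "gr_superfluous N \<longleftrightarrow> graded_submodule N \<and>
     (\<forall>X. graded_submodule X \<and> N + X = UNIV \<longrightarrow> X = UNIV)"

definition gr_essential :: "'m set \<Rightarrow> bool" where
  "gr_essential N \<longleftrightarrow> graded_submodule N \<and>
     (\<forall>X. graded_submodule X \<and> N \<inter> X = {0} \<longrightarrow> X = {0})"

text \<open>
  Without gr-maximal submodules the intersection below is \<open>UNIV\<close>, i.e. the whole module;
  without gr-simple submodules the sum below is \<open>{0}\<close>.
\<close>

definition rad_gr :: "'m set" where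
  "rad_gr = \<Inter> {N. gr_maximal N}"

definition soc_gr :: "'m set" where
  "soc_gr = family_sum {N. gr_simple N} (\<lambda>N. N)"

end

end

theory Submission
  imports Defs
begin

text \<open>
  Both formulas are statements about the lattice of graded submodules. What is used of it is
  that it consists of subgroups and is closed under arbitrary intersections
  (\<open>graded_Inter\<close>) and arbitrary sums (\<open>graded_family_sum\<close>). For intersections the reason is
  that homogeneous components are unique, so that a graded submodule contains the components of
  each of its elements. Two consequences carry the argument. Every element \<open>x\<close> lies in a smallest
  graded submodule \<open>gr_span x\<close>; and unions of chains are graded, so by Zorn's lemma
  (\<open>maximal_graded_disjoint\<close>) there are graded submodules maximal with respect to avoiding a
  given set.

  Radical. A gr-superfluous \<open>N\<close> lies in every gr-maximal \<open>K\<close>, since otherwise \<open>N + K\<close> is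
  everything. Conversely, if \<open>x\<close> is in the radical then \<open>gr_span x\<close> is gr-superfluous: if
  \<open>gr_span x + X\<close> is everything and \<open>X\<close> is proper, then \<open>x \<notin> X\<close>, and a graded submodule
  that contains \<open>X\<close> and is maximal with respect to avoiding \<open>x\<close> is gr-maximal.

  Socle. A gr-simple submodule meets a gr-essential one nontrivially, hence lies in it. Conversely
  let \<open>E\<close> be the intersection of all gr-essential submodules. Every graded \<open>X\<close> has a
  graded \<open>C\<close> with \<open>X \<inter> C = {0}\<close> and \<open>X + C\<close> gr-essential (\<open>essential_complement\<close>), so that
  \<open>E \<subseteq> X + C\<close>. This splitting produces a gr-simple submodule inside every nonzero graded
  submodule of \<open>E\<close> (\<open>gr_simple_below\<close>). For \<open>X\<close> the socle it follows that \<open>E \<inter> C = {0}\<close>,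
  and then \<open>E\<close> is contained in the socle by the modular law.
\<close>

section \<open>Sums of families of subgroups\<close>

lemma add_subgroup_zero: "add_subgroup A \<Longrightarrow> 0 \<in> A"
  and add_subgroup_add: "add_subgroup A \<Longrightarrow> x \<in> A \<Longrightarrow> y \<in> A \<Longrightarrow> x + y \<in> A"
  and add_subgroup_uminus: "add_subgroup A \<Longrightarrow> x \<in> A \<Longrightarrow> - x \<in> A"
  by (auto simp: add_subgroup_def)

lemma add_subgroup_diff:
  assumes "add_subgroup A" "x \<in> A" "y \<in> A"
  shows "x - y \<in> A"
  using add_subgroup_add[OF assms(1,2) add_subgroup_uminus[OF assms(1,3)]] by simp

lemma add_subgroup_sum:
  assumes "add_subgroup A" "\<And>i. i \<in> F \<Longrightarrow> f i \<in> A"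
  shows "sum f F \<in> A"
  using assms(2)
  by (induction F rule: infinite_finite_induct)
     (auto intro: add_subgroup_zero add_subgroup_add assms(1))

lemma add_subgroup_Inter: "(\<And>N. N \<in> \<N> \<Longrightarrow> add_subgroup N) \<Longrightarrow> add_subgroup (\<Inter>\<N>)"
  by (auto simp: add_subgroup_def)

lemma family_sumI:
  "finite F \<Longrightarrow> F \<subseteq> I \<Longrightarrow> (\<And>i. i \<in> F \<Longrightarrow> f i \<in> A i) \<Longrightarrow> sum f F \<in> family_sum I A"
  by (auto simp: family_sum_def)

lemma family_sumE:
  assumes "x \<in> family_sum I A"
  obtains F f where "finite F" "F \<subseteq> I" "\<forall>i\<in>F. f i \<in> A i" "x = sum f F"
  using assms by (auto simp: family_sum_def)

lemma family_sum_upper: "i \<in> I \<Longrightarrow> A i \<subseteq> family_sum I A"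
  using family_sumI[of "{i}" I "\<lambda>_. _" A] by auto

lemma family_sum_least:
  assumes "add_subgroup B" "\<And>i. i \<in> I \<Longrightarrow> A i \<subseteq> B"
  shows "family_sum I A \<subseteq> B"
  using assms by (fastforce elim!: family_sumE intro!: add_subgroup_sum)

lemma add_subgroup_family_sum:
  assumes A: "\<And>i. i \<in> I \<Longrightarrow> add_subgroup (A i)"
  shows "add_subgroup (family_sum I A)"
  unfolding add_subgroup_def
proof (intro conjI ballI)
  show "0 \<in> family_sum I A"
    using family_sumI[of "{}" I] by simp
next
  fix x y assume x: "x \<in> family_sum I A" and y: "y \<in> family_sum I A"
  from x obtain F f where
    F: "finite F" "F \<subseteq> I" "\<forall>i\<in>F. f i \<in> A i" "x = sum f F"
    by (rule family_sumE)
  from y obtain G g where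
    G: "finite G" "G \<subseteq> I" "\<forall>i\<in>G. g i \<in> A i" "y = sum g G"
    by (rule family_sumE)
  let ?f = "\<lambda>i. if i \<in> F then f i else 0" and ?g = "\<lambda>i. if i \<in> G then g i else 0"
  have zero: "0 \<in> A i" if "i \<in> I" for i
    using add_subgroup_zero[OF A[OF that]] .
  have "x = sum ?f (F \<union> G)" "y = sum ?g (F \<union> G)"
    unfolding F(4) G(4) by (rule sum.mono_neutral_cong_left; use F G in auto)+
  hence "x + y = (\<Sum>i\<in>F \<union> G. ?f i + ?g i)"
    by (simp add: sum.distrib)
  also have "\<dots> \<in> family_sum I A"
    using F G A by (intro family_sumI add_subgroup_add) (auto intro!: zero)
  finally show "x + y \<in> family_sum I A" .
next
  fix x assume "x \<in> family_sum I A"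
  then obtain F f where
    F: "finite F" "F \<subseteq> I" "\<forall>i\<in>F. f i \<in> A i" "x = sum f F"
    by (rule family_sumE)
  have "- x = (\<Sum>i\<in>F. - f i)"
    by (simp add: F(4) sum_negf)
  also have "\<dots> \<in> family_sum I A"
    using F A by (intro family_sumI add_subgroup_uminus) auto
  finally show "- x \<in> family_sum I A" .
qed

lemma family_sum_pair:
  assumes "add_subgroup A" "add_subgroup B"
  shows "family_sum {A, B} (\<lambda>N. N) = A + B"
proof
  have sub: "add_subgroup (family_sum {A, B} (\<lambda>N. N))"
    using assms by (intro add_subgroup_family_sum) auto
  have "A \<subseteq> family_sum {A, B} (\<lambda>N. N)" "B \<subseteq> family_sum {A, B} (\<lambda>N. N)"
    using family_sum_upper[of _ "{A, B}" "\<lambda>N. N"] by auto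
  thus "A + B \<subseteq> family_sum {A, B} (\<lambda>N. N)"
    using add_subgroup_add[OF sub] by (auto elim!: set_plus_elim)
next
  show "family_sum {A, B} (\<lambda>N. N) \<subseteq> A + B"
  proof
    fix x assume "x \<in> family_sum {A, B} (\<lambda>N. N)"
    then obtain F f where
      F: "finite F" "F \<subseteq> {A, B}" "\<forall>N\<in>F. f N \<in> N" "x = sum f F"
      by (rule family_sumE)
    have "x = sum f (F \<inter> {A}) + sum f (F - {A})"
      using F(1,4) by (metis sum.Int_Diff)
    moreover have "sum f (F \<inter> {A}) \<in> A" "sum f (F - {A}) \<in> B"
      using F assms by (auto intro!: add_subgroup_sum)
    ultimately show "x \<in> A + B"
      by (auto intro: set_plus_intro)
  qed
qed

lemma subset_plus_left:
  assumes "add_subgroup B" shows "A \<subseteq> A + B"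
proof
  fix x assume "x \<in> A"
  thus "x \<in> A + B"
    using set_plus_intro[of x A 0 B] add_subgroup_zero[OF assms] by simp
qed

lemma subset_plus_right: "add_subgroup A \<Longrightarrow> B \<subseteq> A + B"
  using subset_plus_left[of A B] by (simp add: add.commute)

lemma plus_subset:
  assumes "add_subgroup C" "A \<subseteq> C" "B \<subseteq> C" shows "A + B \<subseteq> C"
  using assms add_subgroup_add by (fastforce elim!: set_plus_elim)

text \<open>
  The sum also decomposes with components in \<open>N\<close>, and the two decompositions agree because
  their difference is a decomposition of \<open>0\<close>. Extending both by \<open>0\<close> to the union of their
  supports covers the indices that occur in only one of them.
\<close>

lemma direct_sum_component_mem:
  assumes D: "direct_sum I A S" and N: "add_subgroup N"
    and F: "finite F" "F \<subseteq> I" "\<And>i. i \<in> F \<Longrightarrow> f i \<in> A i"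
    and mem: "sum f F \<in> family_sum I (\<lambda>i. N \<inter> A i)" and i: "i \<in> F"
  shows "f i \<in> N"
proof -
  from mem obtain G g where
    G: "finite G" "G \<subseteq> I" "\<forall>i\<in>G. g i \<in> N \<inter> A i" "sum f F = sum g G"
    by (rule family_sumE)
  let ?f = "\<lambda>i. if i \<in> F then f i else 0" and ?g = "\<lambda>i. if i \<in> G then g i else 0"
  let ?h = "\<lambda>i. ?f i - ?g i"
  have sub: "add_subgroup (A i)" if "i \<in> I" for i
    using D that by (auto simp: direct_sum_def)
  have "sum f F = sum ?f (F \<union> G)" "sum g G = sum ?g (F \<union> G)"
    by (rule sum.mono_neutral_cong_left; use F G in auto)+
  hence "(\<Sum>i\<in>F \<union> G. ?h i) = 0"
    using G(4) by (simp add: sum_subtractf)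
  moreover have "\<forall>i\<in>F \<union> G. ?h i \<in> A i"
  proof
    fix i assume "i \<in> F \<union> G"
    hence "i \<in> I" using F G by auto
    thus "?h i \<in> A i"
      using F(3) G(3) add_subgroup_zero[OF sub] by (intro add_subgroup_diff sub) auto
  qed
  moreover have "finite (F \<union> G)" "F \<union> G \<subseteq> I"
    using F G by auto
  moreover have "\<forall>i\<in>H. h i = 0"
    if "finite H" "H \<subseteq> I" "\<forall>i\<in>H. h i \<in> A i" "sum h H = 0" for H h
    using D that by (simp add: direct_sum_def)
  ultimately have "\<forall>i\<in>F \<union> G. ?h i = 0"
    by presburger
  hence "?h i = 0" by (rule bspec) (simp add: i)
  hence "?f i = ?g i" by (rule right_minus_eq[THEN iffD1])
  thus ?thesis
    using i G(3) add_subgroup_zero[OF N] by (auto split: if_splits)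
qed

section \<open>The lattice of graded submodules\<close>

context graded_module
begin

lemma graded_add_subgroup: "graded_submodule N \<Longrightarrow> add_subgroup N"
  by (simp add: graded_submodule_def submodule_def)

text \<open>Independence of the homogeneous parts is inherited from the module itself.\<close>

lemma graded_submodule_iff:
  "graded_submodule N \<longleftrightarrow> submodule N \<and> N \<subseteq> family_sum \<Gamma> (\<lambda>\<gamma>. N \<inter> M \<gamma>)"
proof
  assume "graded_submodule N"
  thus "submodule N \<and> N \<subseteq> family_sum \<Gamma> (\<lambda>\<gamma>. N \<inter> M \<gamma>)"
    by (auto simp: graded_submodule_def direct_sum_def)
next
  assume N: "submodule N \<and> N \<subseteq> family_sum \<Gamma> (\<lambda>\<gamma>. N \<inter> M \<gamma>)"
  hence sub: "add_subgroup N" by (simp add: submodule_def)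
  have "family_sum \<Gamma> (\<lambda>\<gamma>. N \<inter> M \<gamma>) \<subseteq> N"
    by (rule family_sum_least[OF sub]) auto
  moreover have "add_subgroup (N \<inter> M \<gamma>)" if "\<gamma> \<in> \<Gamma>" for \<gamma>
    using sub module_direct_sum that by (auto simp: direct_sum_def add_subgroup_def)
  ultimately show "graded_submodule N"
    using N module_direct_sum unfolding graded_submodule_def direct_sum_def
    by (smt (verit, best) IntE subset_antisym)
qed

lemma submodule_Inter: "(\<And>N. N \<in> \<N> \<Longrightarrow> submodule N) \<Longrightarrow> submodule (\<Inter>\<N>)"
  by (auto simp: submodule_def intro: add_subgroup_Inter)

text \<open>
  The homogeneous components of an element of the intersection, taken in the whole module, lie in
  every member of \<open>\<N>\<close> by uniqueness.
\<close>

lemma graded_Inter: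
  assumes \<N>: "\<And>N. N \<in> \<N> \<Longrightarrow> graded_submodule N"
  shows "graded_submodule (\<Inter>\<N>)"
  unfolding graded_submodule_iff
proof (intro conjI subsetI)
  show "submodule (\<Inter>\<N>)"
    using \<N> by (intro submodule_Inter) (simp add: graded_submodule_def)
next
  fix x assume x: "x \<in> \<Inter>\<N>"
  have "x \<in> family_sum \<Gamma> M"
    using module_direct_sum by (auto simp: direct_sum_def)
  then obtain F f where
    F: "finite F" "F \<subseteq> \<Gamma>" "\<forall>\<gamma>\<in>F. f \<gamma> \<in> M \<gamma>" "x = sum f F"
    by (rule family_sumE)
  have "f \<gamma> \<in> N" if "\<gamma> \<in> F" "N \<in> \<N>" for \<gamma> N
  proof (rule direct_sum_component_mem[OF module_direct_sum])
    show "sum f F \<in> family_sum \<Gamma> (\<lambda>\<gamma>. N \<inter> M \<gamma>)"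
      using x F(4) \<N> that by (auto simp: graded_submodule_iff)
  qed (use F that \<N> graded_add_subgroup in auto)
  thus "x \<in> family_sum \<Gamma> (\<lambda>\<gamma>. \<Inter>\<N> \<inter> M \<gamma>)"
    unfolding F(4) using F by (intro family_sumI) auto
qed

lemma zero_act: "0 \<bullet> a = 0"
  using act_add_left[of 0 0 a] by simp

lemma uminus_act: "(- x) \<bullet> a = - (x \<bullet> a)"
  using act_add_left[of "- x" x a] by (simp add: zero_act eq_neg_iff_add_eq_0)

lemma graded_family_sum:
  assumes \<N>: "\<And>N. N \<in> \<N> \<Longrightarrow> graded_submodule N"
  shows "graded_submodule (family_sum \<N> (\<lambda>N. N))"
proof -
  let ?S = "family_sum \<N> (\<lambda>N. N)"
  have S: "add_subgroup ?S"
    using \<N> by (intro add_subgroup_family_sum graded_add_subgroup)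
  \<comment> \<open>Closure under the action and being spanned by homogeneous elements both say that \<open>?S\<close>
     lies in a certain subgroup, which has to be checked on the members of \<open>\<N>\<close> only.\<close>
  have "?S \<subseteq> {x. \<forall>a. x \<bullet> a \<in> ?S}"
  proof (rule family_sum_least)
    show "add_subgroup {x. \<forall>a. x \<bullet> a \<in> ?S}"
      unfolding add_subgroup_def
      using add_subgroup_zero[OF S] add_subgroup_add[OF S] add_subgroup_uminus[OF S]
      by (auto simp: zero_act uminus_act act_add_left)
  next
    fix N assume "N \<in> \<N>"
    thus "N \<subseteq> {x. \<forall>a. x \<bullet> a \<in> ?S}"
      using \<N>[of N] family_sum_upper[of N \<N> "\<lambda>N. N"]
      by (auto simp: graded_submodule_def submodule_def)
  qed
  moreover have "?S \<subseteq> family_sum \<Gamma> (\<lambda>\<gamma>. ?S \<inter> M \<gamma>)"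
  proof (rule family_sum_least)
    show H: "add_subgroup (family_sum \<Gamma> (\<lambda>\<gamma>. ?S \<inter> M \<gamma>))"
      using S module_direct_sum
      by (intro add_subgroup_family_sum) (auto simp: direct_sum_def add_subgroup_def)
    fix N assume N: "N \<in> \<N>"
    have "N \<subseteq> family_sum \<Gamma> (\<lambda>\<gamma>. N \<inter> M \<gamma>)"
      using \<N>[OF N] by (simp add: graded_submodule_iff)
    also have "\<dots> \<subseteq> family_sum \<Gamma> (\<lambda>\<gamma>. ?S \<inter> M \<gamma>)"
    proof (rule family_sum_least[OF H])
      fix \<gamma> assume "\<gamma> \<in> \<Gamma>"
      thus "N \<inter> M \<gamma> \<subseteq> family_sum \<Gamma> (\<lambda>\<gamma>. ?S \<inter> M \<gamma>)"
        using family_sum_upper[of \<gamma> \<Gamma> "\<lambda>\<gamma>. ?S \<inter> M \<gamma>"]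
          family_sum_upper[OF N, of "\<lambda>N. N"] by blast
    qed
    finally show "N \<subseteq> family_sum \<Gamma> (\<lambda>\<gamma>. ?S \<inter> M \<gamma>)" .
  qed
  ultimately show ?thesis
    using S by (auto simp: graded_submodule_iff submodule_def)
qed

lemma graded_zero: "graded_submodule {0}"
  using graded_family_sum[of "{}"] by (simp add: family_sum_def)

lemma graded_Int: "graded_submodule A \<Longrightarrow> graded_submodule B \<Longrightarrow> graded_submodule (A \<inter> B)"
  using graded_Inter[of "{A, B}"] by auto

lemma graded_plus:
  assumes "graded_submodule A" "graded_submodule B"
  shows "graded_submodule (A + B)"
  using graded_family_sum[of "{A, B}"] assms
  by (auto simp: family_sum_pair graded_add_subgroup)

text \<open>The union of a chain of subgroups is a subgroup, so it is the sum of the chain.\<close>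

lemma graded_Union_chain:
  assumes C: "\<And>N. N \<in> C \<Longrightarrow> graded_submodule N" "C \<noteq> {}"
    and chain: "\<And>A B. A \<in> C \<Longrightarrow> B \<in> C \<Longrightarrow> A \<subseteq> B \<or> B \<subseteq> A"
  shows "graded_submodule (\<Union>C)"
proof -
  have sub: "add_subgroup N" if "N \<in> C" for N
    using C that by (simp add: graded_add_subgroup)
  have "add_subgroup (\<Union>C)"
    unfolding add_subgroup_def
  proof (intro conjI ballI)
    show "0 \<in> \<Union>C"
      using C(2) add_subgroup_zero[OF sub] by auto
  next
    fix x y assume "x \<in> \<Union>C" "y \<in> \<Union>C"
    then obtain N where "N \<in> C" "x \<in> N" "y \<in> N"
      using chain by blast
    thus "x + y \<in> \<Union>C"
      using add_subgroup_add[OF sub] by blast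
  next
    fix x assume "x \<in> \<Union>C"
    thus "- x \<in> \<Union>C"
      using add_subgroup_uminus[OF sub] by blast
  qed
  hence "family_sum C (\<lambda>N. N) = \<Union>C"
    using family_sum_least[of "\<Union>C" C "\<lambda>N. N"] family_sum_upper[of _ C "\<lambda>N. N"] by blast
  thus ?thesis
    using graded_family_sum[of C] C(1) by simp
qed

text \<open>
  Avoiding a set, rather than a single element, serves three purposes: \<open>A = {x}\<close> gives gr-maximal
  submodules, \<open>A = X - {0}\<close> gives complements of \<open>X\<close>, and putting the outside of some \<open>G\<close> into
  \<open>A\<close> confines the search to \<open>G\<close>.
\<close>

lemma maximal_graded_disjoint:
  assumes X: "graded_submodule X" "X \<inter> A = {}"
  obtains Y where "graded_submodule Y" "X \<subseteq> Y" "Y \<inter> A = {}"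
    "\<forall>Z. graded_submodule Z \<longrightarrow> Y \<subseteq> Z \<longrightarrow> Z \<inter> A = {} \<longrightarrow> Z = Y"
proof -
  let ?P = "{Y. graded_submodule Y \<and> X \<subseteq> Y \<and> Y \<inter> A = {}}"
  have "\<exists>Y\<in>?P. \<forall>Z\<in>?P. Y \<subseteq> Z \<longrightarrow> Z = Y"
  proof (rule subset_Zorn_nonempty)
    show "?P \<noteq> {}" using X by auto
  next
    fix C assume C: "C \<noteq> {}" "subset.chain ?P C"
    have "graded_submodule (\<Union>C)"
    proof (rule graded_Union_chain)
      show "graded_submodule N" if "N \<in> C" for N
        using C(2) that by (auto simp: subset_chain_def)
      show "N \<subseteq> N' \<or> N' \<subseteq> N" if "N \<in> C" "N' \<in> C" for N N'
        using C(2) that by (auto simp: subset_chain_def)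
    qed (fact C(1))
    moreover have "\<forall>N\<in>C. X \<subseteq> N \<and> N \<inter> A = {}"
      using C(2) by (auto simp: subset_chain_def)
    ultimately show "\<Union>C \<in> ?P"
      using C(1) by blast
  qed
  then obtain Y where Y: "graded_submodule Y" "X \<subseteq> Y" "Y \<inter> A = {}"
    and max: "\<forall>Z\<in>?P. Y \<subseteq> Z \<longrightarrow> Z = Y"
    by blast
  have "\<forall>Z. graded_submodule Z \<longrightarrow> Y \<subseteq> Z \<longrightarrow> Z \<inter> A = {} \<longrightarrow> Z = Y"
    using max Y(2) by (metis (mono_tags, lifting) mem_Collect_eq subset_trans)
  thus thesis by (rule that[OF Y])
qed

definition gr_span :: "'m \<Rightarrow> 'm set" where
  "gr_span x = \<Inter> {N. graded_submodule N \<and> x \<in> N}"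

lemma graded_gr_span: "graded_submodule (gr_span x)"
  unfolding gr_span_def by (rule graded_Inter) auto

lemma mem_gr_span: "x \<in> gr_span x"
  by (simp add: gr_span_def)

lemma gr_span_subset: "graded_submodule N \<Longrightarrow> x \<in> N \<Longrightarrow> gr_span x \<subseteq> N"
  by (auto simp: gr_span_def)

section \<open>The graded radical\<close>

lemma gr_superfluous_subset_gr_maximal:
  assumes N: "gr_superfluous N" and K: "gr_maximal K"
  shows "N \<subseteq> K"
proof (rule ccontr)
  assume "\<not> N \<subseteq> K"
  have gr: "graded_submodule N" "graded_submodule K"
    using N K by (auto simp: gr_superfluous_def gr_maximal_def)
  have "N \<subseteq> N + K" "K \<subseteq> N + K"
    using gr by (auto intro!: subset_plus_left subset_plus_right graded_add_subgroup)
  hence "N + K = UNIV"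
    using K graded_plus[OF gr] \<open>\<not> N \<subseteq> K\<close> unfolding gr_maximal_def by blast
  hence "K = UNIV"
    using N gr by (auto simp: gr_superfluous_def)
  thus False using K by (simp add: gr_maximal_def)
qed

lemma gr_superfluous_gr_span:
  assumes x: "x \<in> rad_gr"
  shows "gr_superfluous (gr_span x)"
  unfolding gr_superfluous_def
proof (intro conjI allI impI)
  show "graded_submodule (gr_span x)" by (rule graded_gr_span)
next
  fix X assume X: "graded_submodule X \<and> gr_span x + X = UNIV"
  \<comment> \<open>A graded submodule containing both summands is everything.\<close>
  have all: "Z = UNIV" if "graded_submodule Z" "X \<subseteq> Z" "x \<in> Z" for Z
    using plus_subset[OF graded_add_subgroup[OF that(1)] gr_span_subset[OF that(1,3)] that(2)] X
    by auto
  show "X = UNIV"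
  proof (cases "x \<in> X")
    case True
    thus ?thesis using all X by blast
  next
    case False
    hence "graded_submodule X" "X \<inter> {x} = {}" using X by auto
    then obtain Y where Y: "graded_submodule Y" "X \<subseteq> Y" "Y \<inter> {x} = {}"
      "\<forall>Z. graded_submodule Z \<longrightarrow> Y \<subseteq> Z \<longrightarrow> Z \<inter> {x} = {} \<longrightarrow> Z = Y"
      by (rule maximal_graded_disjoint)
    have "gr_maximal Y"
      unfolding gr_maximal_def
    proof (intro conjI allI impI)
      fix Z assume Z: "graded_submodule Z \<and> Z \<noteq> UNIV \<and> Y \<subseteq> Z"
      hence "x \<notin> Z" using all[of Z] Y(2) by auto
      thus "Z = Y" using Y(4) Z by auto
    qed (use Y in auto)
    hence "x \<in> Y" using x by (auto simp: rad_gr_def)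
    thus ?thesis using Y(3) by auto
  qed
qed

theorem rad_gr_eq_sum_gr_superfluous:
  "rad_gr = family_sum {N. gr_superfluous N} (\<lambda>N. N)"
proof
  show "rad_gr \<subseteq> family_sum {N. gr_superfluous N} (\<lambda>N. N)"
  proof
    fix x assume "x \<in> rad_gr"
    hence "gr_superfluous (gr_span x)" by (rule gr_superfluous_gr_span)
    thus "x \<in> family_sum {N. gr_superfluous N} (\<lambda>N. N)"
      using family_sum_upper[of "gr_span x" "{N. gr_superfluous N}" "\<lambda>N. N"] mem_gr_span
      by auto
  qed
next
  have "add_subgroup rad_gr"
    unfolding rad_gr_def
    by (rule add_subgroup_Inter) (auto simp: gr_maximal_def graded_add_subgroup)
  thus "family_sum {N. gr_superfluous N} (\<lambda>N. N) \<subseteq> rad_gr"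
    by (rule family_sum_least) (auto simp: rad_gr_def dest: gr_superfluous_subset_gr_maximal)
qed

section \<open>The graded socle\<close>

lemma gr_simple_subset_gr_essential:
  assumes S: "gr_simple S" and N: "gr_essential N"
  shows "S \<subseteq> N"
proof -
  have gr: "graded_submodule S" "graded_submodule N"
    using S N by (auto simp: gr_simple_def gr_essential_def)
  have "N \<inter> S \<noteq> {0}"
    using S N gr by (auto simp: gr_simple_def gr_essential_def)
  hence "N \<inter> S = S"
    using S graded_Int[OF gr(2,1)] by (auto simp: gr_simple_def)
  thus ?thesis by blast
qed

text \<open>
  Take \<open>C\<close> maximal among the graded submodules meeting \<open>X\<close> trivially. If \<open>Z\<close> meets \<open>X + C\<close>
  trivially, then \<open>C + Z\<close> still meets \<open>X\<close> trivially, so \<open>Z \<subseteq> C\<close> by maximality and \<open>Z\<close> is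
  zero.
\<close>

lemma essential_complement:
  assumes X: "graded_submodule X"
  obtains C where "graded_submodule C" "X \<inter> C = {0}" "gr_essential (X + C)"
proof -
  have "{0} \<inter> (X - {0}) = {}" by simp
  from graded_zero this obtain C where C: "graded_submodule C" "{0} \<subseteq> C" "C \<inter> (X - {0}) = {}"
    "\<forall>Z. graded_submodule Z \<longrightarrow> C \<subseteq> Z \<longrightarrow> Z \<inter> (X - {0}) = {} \<longrightarrow> Z = C"
    by (rule maximal_graded_disjoint)
  have XC: "X \<inter> C = {0}"
    using C(3) add_subgroup_zero[OF graded_add_subgroup] X C(1) by auto
  have "gr_essential (X + C)"
    unfolding gr_essential_def
  proof (intro conjI allI impI)
    show "graded_submodule (X + C)" using X C(1) by (rule graded_plus)
  next
    fix Z assume "graded_submodule Z \<and> (X + C) \<inter> Z = {0}"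
    hence Z: "graded_submodule Z" "(X + C) \<inter> Z = {0}" by auto
    note sg = graded_add_subgroup[OF X] graded_add_subgroup[OF C(1)] graded_add_subgroup[OF Z(1)]
    have "(C + Z) \<inter> (X - {0}) = {}"
    proof (rule ccontr)
      assume "(C + Z) \<inter> (X - {0}) \<noteq> {}"
      then obtain c z where cz: "c \<in> C" "z \<in> Z" "c + z \<in> X" "c + z \<noteq> 0"
        by (auto elim!: set_plus_elim)
      have "(c + z) + (- c) \<in> X + C"
        by (intro set_plus_intro cz add_subgroup_uminus[OF sg(2)])
      hence "z = 0" using Z(2) cz(2) by auto
      thus False using cz XC by auto
    qed
    hence "C + Z = C"
      using C(4)[rule_format, OF graded_plus[OF C(1) Z(1)]] subset_plus_left[OF sg(3)] by blast
    hence "Z \<subseteq> X + C"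
      using subset_plus_right[OF sg(2), of Z] subset_plus_right[OF sg(1), of C] by auto
    thus "Z = {0}" using Z(2) by auto
  qed
  thus thesis using that C(1) XC by blast
qed

text \<open>
  Inside \<open>G = gr_span x\<close>, for some nonzero \<open>x \<in> D\<close>, choose \<open>Y\<close> maximal with respect to
  avoiding \<open>x\<close>. Then \<open>Y\<close> is maximal in \<open>G\<close>, so the quotient \<open>G / Y\<close> is gr-simple, and since
  \<open>G\<close> splits over \<open>Y\<close> this quotient is realised as the submodule \<open>G \<inter> C\<close> of \<open>D\<close>.
\<close>

lemma gr_simple_below:
  assumes D: "graded_submodule D" "D \<noteq> {0}" "D \<subseteq> \<Inter> {N. gr_essential N}"
  obtains T where "gr_simple T" "T \<subseteq> D"
proof -
  obtain x where x: "x \<in> D" "x \<noteq> 0"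
    using D(2) add_subgroup_zero[OF graded_add_subgroup[OF D(1)]] by blast
  define G where "G = gr_span x"
  have G: "graded_submodule G" "x \<in> G" "G \<subseteq> D"
    using graded_gr_span mem_gr_span gr_span_subset[OF D(1) x(1)] by (auto simp: G_def)
  note sgG = graded_add_subgroup[OF G(1)]
  have "{0} \<inter> insert x (- G) = {}"
    using x(2) add_subgroup_zero[OF sgG] by auto
  from graded_zero this obtain Y where Y: "graded_submodule Y" "{0} \<subseteq> Y" "Y \<inter> insert x (- G) = {}"
    "\<forall>Z. graded_submodule Z \<longrightarrow> Y \<subseteq> Z \<longrightarrow> Z \<inter> insert x (- G) = {} \<longrightarrow> Z = Y"
    by (rule maximal_graded_disjoint)
  have YG: "Y \<subseteq> G" "x \<notin> Y" using Y(3) by auto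
  note sgY = graded_add_subgroup[OF Y(1)]
  obtain C where C: "graded_submodule C" "Y \<inter> C = {0}" "gr_essential (Y + C)"
    using essential_complement[OF Y(1)] by blast
  note sgC = graded_add_subgroup[OF C(1)]
  have GYC: "G \<subseteq> Y + C" using D(3) G(3) C(3) by blast
  have "gr_simple (G \<inter> C)"
    unfolding gr_simple_def
  proof (intro conjI allI impI)
    show "graded_submodule (G \<inter> C)" using G(1) C(1) by (rule graded_Int)
    obtain y c where yc: "y \<in> Y" "c \<in> C" "x = y + c"
      using G(2) GYC by (auto elim!: set_plus_elim)
    have "x - y \<in> G" using sgG G(2) YG(1) yc(1) by (intro add_subgroup_diff) auto
    hence "c \<in> G \<inter> C" using yc by simp
    moreover have "c \<noteq> 0" using yc YG(2) by auto
    ultimately show "G \<inter> C \<noteq> {0}" by blast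
  next
    fix Z assume "graded_submodule Z \<and> Z \<noteq> {0} \<and> Z \<subseteq> G \<inter> C"
    hence Z: "graded_submodule Z" "Z \<noteq> {0}" "Z \<subseteq> G" "Z \<subseteq> C" by auto
    note sgZ = graded_add_subgroup[OF Z(1)]
    have YZG: "Y + Z \<subseteq> G" by (rule plus_subset[OF sgG YG(1) Z(3)])
    have "x \<in> Y + Z"
    proof (rule ccontr)
      assume "x \<notin> Y + Z"
      hence "Y + Z = Y"
        using Y(4)[rule_format, OF graded_plus[OF Y(1) Z(1)] subset_plus_left[OF sgZ]] YZG by auto
      hence "Z \<subseteq> Y \<inter> C" using subset_plus_right[OF sgY, of Z] Z(4) by auto
      thus False using C(2) Z(2) add_subgroup_zero[OF sgZ] by auto
    qed
    hence GYZ: "G \<subseteq> Y + Z"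
      unfolding G_def using graded_plus[OF Y(1) Z(1)] by (intro gr_span_subset)
    have "G \<inter> C \<subseteq> Z"
    proof
      fix t assume t: "t \<in> G \<inter> C"
      then obtain y z where yz: "y \<in> Y" "z \<in> Z" "t = y + z"
        using GYZ by (auto elim!: set_plus_elim)
      have "t - z \<in> C" using t yz Z(4) by (intro add_subgroup_diff[OF sgC]) auto
      hence "y \<in> Y \<inter> C" using yz by simp
      thus "t \<in> Z" using C(2) yz by auto
    qed
    thus "Z = G \<inter> C" using Z by auto
  qed
  thus thesis using that[of "G \<inter> C"] G(3) by auto
qed

theorem soc_gr_eq_Inter_gr_essential:
  "soc_gr = \<Inter> {N. gr_essential N}"
proof
  let ?E = "\<Inter> {N. gr_essential N}"
  have gE: "graded_submodule ?E"
    by (rule graded_Inter) (auto simp: gr_essential_def)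
  note sgE = graded_add_subgroup[OF gE]
  show le: "soc_gr \<subseteq> ?E"
    unfolding soc_gr_def
    by (rule family_sum_least[OF sgE]) (auto dest: gr_simple_subset_gr_essential)
  have gS: "graded_submodule soc_gr"
    unfolding soc_gr_def by (rule graded_family_sum) (auto simp: gr_simple_def)
  obtain C where C: "graded_submodule C" "soc_gr \<inter> C = {0}" "gr_essential (soc_gr + C)"
    using essential_complement[OF gS] by blast
  have "?E \<inter> C = {0}"
  proof (rule ccontr)
    assume "?E \<inter> C \<noteq> {0}"
    then obtain T where T: "gr_simple T" "T \<subseteq> ?E \<inter> C"
      using gr_simple_below[OF graded_Int[OF gE C(1)]] by blast
    have "T \<subseteq> soc_gr"
      unfolding soc_gr_def using T(1) family_sum_upper[of T "{N. gr_simple N}" "\<lambda>N. N"] by simp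
    hence "T \<subseteq> {0}" using T(2) C(2) by blast
    moreover have "graded_submodule T" "T \<noteq> {0}"
      using T(1) by (auto simp: gr_simple_def)
    ultimately show False
      using add_subgroup_zero[OF graded_add_subgroup] by blast
  qed
  show "?E \<subseteq> soc_gr"
  proof
    fix x assume x: "x \<in> ?E"
    hence "x \<in> soc_gr + C" using C(3) by blast
    then obtain s c where sc: "s \<in> soc_gr" "c \<in> C" "x = s + c"
      by (auto elim!: set_plus_elim)
    have "x - s \<in> ?E" using x sc(1) le by (intro add_subgroup_diff[OF sgE]) blast+
    hence "c \<in> ?E \<inter> C" using sc by simp
    hence "c = 0" using \<open>?E \<inter> C = {0}\<close> by blast
    thus "x \<in> soc_gr" using sc by simp
  qed
qed

end

theorem proposition4p16:
  fixes \<Gamma> :: "'g set" and d r :: "'g \<Rightarrow> 'g" and mul :: "'g \<Rightarrow> 'g \<Rightarrow> 'g"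
    and R :: "'g \<Rightarrow> 'r::ring set"
    and act :: "'m::ab_group_add \<Rightarrow> 'r \<Rightarrow> 'm" and M :: "'g \<Rightarrow> 'm set"
  assumes "graded_module \<Gamma> d r mul R act M"
  shows "(graded_module.rad_gr \<Gamma> act M
           = family_sum {N. graded_module.gr_superfluous \<Gamma> act M N} (\<lambda>N. N))
       \<and> (graded_module.soc_gr \<Gamma> act M
           = \<Inter> {N. graded_module.gr_essential \<Gamma> act M N})"
proof -
  interpret graded_module \<Gamma> d r mul R act M by (fact assms)
  show ?thesis
    using rad_gr_eq_sum_gr_superfluous soc_gr_eq_Inter_gr_essential by blast
qed

end
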